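(* Let $\eta,\zeta:\Omega\to\mathbb{R}$ be prescribed continuously differentiable functions. Then for every classical solution $\omega_1$ (a $k$-form on $\Omega$) of the nonlinear Hodge–Frobenius system $$d*\big(\rho\,\omega\big)=\Sigma\wedge *\big(\rho\,\omega\big),\qquad d\omega=\Gamma\wedge\omega,$$ with mass density $\rho=\rho_1$ and coefficients $\Sigma=d\zeta$ and $\Gamma=d\eta$, there is a classical solution $\omega_0$ of the nonlinear Hodge equations $$\delta(\rho\,\omega)=0,\qquad d\omega=0,$$ with density $\rho=\rho_0$. Here $\rho_0$ depends on $\rho_1$, $\eta$ and $\zeta$; $\omega_0$ is related to $\omega_1$ by $C^1$ conformal transformations. The converse also holds. Ellipticity is preserved by this correspondence.
   Context: $\Omega$ is a smooth open domain in $\mathbb{R}^n$; $d$ is the exterior derivative, $\delta$ its formal adjoint, $*$ the Hodge duality operator, and $|\omega|^2=*(\omega\wedge*\omega)$. A mass density $\rho$ is a positive function of $Q=|\omega|^2$, which may also depend explicitly on $x\in\Omega$. Ellipticity for a density $\rho$ means $0<\rho^2+2Q\rho'\rho$, where the prime is the derivative in $Q$; equivalently, $\partial_Q(Q\rho^2)>0$. *)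

theory Defs
  imports "HOL-Analysis.Analysis"
begin

section \<open>Exterior algebra of Euclidean space\<close>

text \<open>
  The exterior algebra of the dual of \<open>real ^ 'n\<close> is \<open>real ^ ('n set)\<close>: the component
  \<open>a $ I\<close> is the coefficient of \<open>dx_I = dx_{i1} \<and> \<dots> \<and> dx_{ik}\<close>, where
  \<open>I = {i1 < \<dots> < ik}\<close>.  The linear order on the index type \<open>'n\<close> numbers the coordinates, hence
  fixes the orientation.  Scalars (\<open>0\<close>-covectors) sit at the index \<open>{}\<close>.
\<close>

type_synonym 'n pt = "real ^ 'n"
type_synonym 'n ext = "real ^ ('n set)"
type_synonym 'n dform = "'n pt \<Rightarrow> 'n ext"

text \<open>For disjoint \<open>I\<close>, \<open>J\<close>: \<open>dx_I \<and> dx_J = shuffle_sign I J \<cdot> dx_{I \<union> J}\<close>; the exponent counts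
  the transpositions needed to sort the concatenation.\<close>

definition shuffle_sign :: "('n::{finite,linorder}) set \<Rightarrow> 'n set \<Rightarrow> real" where
  "shuffle_sign I J = (-1) ^ card {(i, j). i \<in> I \<and> j \<in> J \<and> j < i}"

definition wedge :: "('n::{finite,linorder}) ext \<Rightarrow> 'n ext \<Rightarrow> 'n ext" (infixr "\<and>\<^sub>w" 75) where
  "a \<and>\<^sub>w b = (\<chi> K. \<Sum>I\<in>Pow K. shuffle_sign I (K - I) * (a $ I) * (b $ (K - I)))"

text \<open>\<open>\<star> dx_I = \<plusminus> dx_{-I}\<close>, the sign being such that \<open>dx_I \<and> \<star> dx_I\<close> is the volume form.\<close>

definition hodge_star :: "('n::{finite,linorder}) ext \<Rightarrow> 'n ext" where
  "hodge_star a = (\<chi> K. shuffle_sign (- K) K * (a $ (- K)))"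

definition norm_sq :: "('n::{finite,linorder}) ext \<Rightarrow> real" where
  "norm_sq a = hodge_star (a \<and>\<^sub>w hodge_star a) $ {}"

definition homogeneous :: "nat \<Rightarrow> ('n::finite) ext \<Rightarrow> bool" where
  "homogeneous k a \<longleftrightarrow> (\<forall>I. card I \<noteq> k \<longrightarrow> a $ I = 0)"


section \<open>Differential forms on open sets\<close>

text \<open>Forms are total functions; only their values on the open set under consideration matter.\<close>

definition form_on :: "nat \<Rightarrow> ('n::finite) pt set \<Rightarrow> 'n dform \<Rightarrow> bool" where
  "form_on k \<Omega> \<omega> \<longleftrightarrow> (\<forall>x\<in>\<Omega>. homogeneous k (\<omega> x))"

definition partial :: "('n::finite) \<Rightarrow> ('n pt \<Rightarrow> 'b::real_normed_vector) \<Rightarrow> 'n pt \<Rightarrow> 'b" where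
  "partial i f x = frechet_derivative f (at x) (axis i 1)"

text \<open>Class \<open>C^m\<close> on an open set.\<close>

primrec Ck_on :: "nat \<Rightarrow> ('n::finite) pt set \<Rightarrow> ('n pt \<Rightarrow> 'b::real_normed_vector) \<Rightarrow> bool" where
  "Ck_on 0 S f \<longleftrightarrow> continuous_on S f"
| "Ck_on (Suc m) S f \<longleftrightarrow> (\<forall>x\<in>S. f differentiable (at x)) \<and> (\<forall>i. Ck_on m S (partial i f))"

definition ext_deriv :: "('n::{finite,linorder}) dform \<Rightarrow> 'n dform" where
  "ext_deriv \<omega> x = (\<Sum>i\<in>UNIV. axis {i} 1 \<and>\<^sub>w partial i \<omega> x)"

definition zero_form :: "(('n::finite) pt \<Rightarrow> real) \<Rightarrow> 'n dform" where
  "zero_form f x = axis {} (f x)"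

text \<open>The differential of a function, as a \<open>1\<close>-form.\<close>

definition differential :: "(('n::{finite,linorder}) pt \<Rightarrow> real) \<Rightarrow> 'n dform" where
  "differential f = ext_deriv (zero_form f)"

text \<open>The codifferential on \<open>k\<close>-forms.  That it is the formal adjoint of \<^const>\<open>ext_deriv\<close> is
  proved below as \<open>codiff_formal_adjoint\<close>.\<close>

definition codiff :: "nat \<Rightarrow> ('n::{finite,linorder}) dform \<Rightarrow> 'n dform" where
  "codiff k \<omega> x =
     (-1) ^ (CARD('n) * (k + 1) + 1) *\<^sub>R hodge_star (ext_deriv (\<lambda>y. hodge_star (\<omega> y)) x)"

lemma shuffle_sign_Un_left:
  "A \<inter> B = {} \<Longrightarrow> shuffle_sign (A \<union> B) C = shuffle_sign A C * shuffle_sign B C"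
proof -
  assume d: "A \<inter> B = {}"
  have "{(i, j). i \<in> A \<union> B \<and> j \<in> C \<and> j < i} =
      {(i, j). i \<in> A \<and> j \<in> C \<and> j < i} \<union> {(i, j). i \<in> B \<and> j \<in> C \<and> j < i}" by auto
  moreover have "{(i, j). i \<in> A \<and> j \<in> C \<and> j < i} \<inter> {(i, j). i \<in> B \<and> j \<in> C \<and> j < i} = {}"
    using d by auto
  ultimately show ?thesis
    unfolding shuffle_sign_def by (simp add: card_Un_disjoint power_add)
qed

lemma shuffle_sign_Un_right:
  "A \<inter> B = {} \<Longrightarrow> shuffle_sign C (A \<union> B) = shuffle_sign C A * shuffle_sign C B"
proof -
  assume d: "A \<inter> B = {}"
  have "{(i, j). i \<in> C \<and> j \<in> A \<union> B \<and> j < i} =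
      {(i, j). i \<in> C \<and> j \<in> A \<and> j < i} \<union> {(i, j). i \<in> C \<and> j \<in> B \<and> j < i}" by auto
  moreover have "{(i, j). i \<in> C \<and> j \<in> A \<and> j < i} \<inter> {(i, j). i \<in> C \<and> j \<in> B \<and> j < i} = {}"
    using d by auto
  ultimately show ?thesis
    unfolding shuffle_sign_def by (simp add: card_Un_disjoint power_add)
qed

lemma shuffle_sign_square [simp]: "shuffle_sign A B * shuffle_sign A B = 1"
  by (simp add: shuffle_sign_def flip: power_mult_distrib)

lemma shuffle_sign_commute:
  assumes "A \<inter> B = {}"
  shows "shuffle_sign A B * shuffle_sign B A = (-1) ^ (card A * card B)"
proof -
  have "A \<times> B = {(i, j). i \<in> A \<and> j \<in> B \<and> j < i} \<union> prod.swap ` {(i, j). i \<in> B \<and> j \<in> A \<and> j < i}"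
    using assms by (auto simp: image_iff neq_iff)
  moreover have "{(i, j). i \<in> A \<and> j \<in> B \<and> j < i} \<inter> prod.swap ` {(i, j). i \<in> B \<and> j \<in> A \<and> j < i} = {}"
    by auto
  ultimately have "card (A \<times> B) = card {(i, j). i \<in> A \<and> j \<in> B \<and> j < i}
      + card (prod.swap ` {(i, j). i \<in> B \<and> j \<in> A \<and> j < i})"
    by (metis (no_types, lifting) card_Un_disjoint finite)
  then show ?thesis
    unfolding shuffle_sign_def
    by (simp add: card_image card_cartesian_product power_add)
qed

lemma norm_sq_eq_inner: "norm_sq a = a \<bullet> a"
proof -
  have "norm_sq a = (\<Sum>I\<in>UNIV. shuffle_sign I (- I) * (a $ I) * (shuffle_sign I (- I) * (a $ I)))"
    unfolding norm_sq_def hodge_star_def wedge_def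
    by (simp add: shuffle_sign_def Compl_eq_Diff_UNIV[symmetric])
  also have "\<dots> = (\<Sum>I\<in>UNIV. a $ I * a $ I)"
  proof (rule sum.cong[OF refl])
    fix I :: "'a set"
    have "shuffle_sign I (- I) * (a $ I) * (shuffle_sign I (- I) * (a $ I))
        = (shuffle_sign I (- I) * shuffle_sign I (- I)) * (a $ I * a $ I)"
      by (simp only: mult_ac)
    then show "shuffle_sign I (- I) * (a $ I) * (shuffle_sign I (- I) * (a $ I)) = a $ I * a $ I"
      by simp
  qed
  finally show ?thesis by (simp add: inner_vec_def)
qed

lemma ext_deriv_component:
  "ext_deriv \<omega> x $ K = (\<Sum>i\<in>K. shuffle_sign {i} (K - {i}) * (partial i \<omega> x $ (K - {i})))"
proof -
  have "(axis {i} 1 \<and>\<^sub>w b) $ K = (if i \<in> K then shuffle_sign {i} (K - {i}) * (b $ (K - {i})) else 0)"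
    for i :: 'a and b
  proof -
    have "(axis {i} 1 \<and>\<^sub>w b) $ K =
        (\<Sum>I\<in>Pow K. if I = {i} then shuffle_sign {i} (K - {i}) * (b $ (K - {i})) else 0)"
      unfolding wedge_def vec_lambda_beta by (rule sum.cong[OF refl]) (auto simp: axis_def)
    then show ?thesis by (simp add: sum.delta)
  qed
  then show ?thesis
    unfolding ext_deriv_def by (simp add: sum.If_cases)
qed

lemma partial_hodge_star:
  fixes \<psi> :: "('a::{finite,linorder}) dform"
  assumes "\<psi> differentiable (at x)"
  shows "partial i (\<lambda>y. hodge_star (\<psi> y)) x = hodge_star (partial i \<psi> x)"
proof -
  have "linear (hodge_star :: 'a ext \<Rightarrow> 'a ext)"
    by (rule linearI) (simp_all add: hodge_star_def vec_eq_iff algebra_simps)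
  then have bl: "bounded_linear (hodge_star :: 'a ext \<Rightarrow> 'a ext)"
    by (simp add: linear_conv_bounded_linear)
  have "(\<psi> has_derivative frechet_derivative \<psi> (at x)) (at x)"
    using assms by (simp add: frechet_derivative_works)
  then have "((\<lambda>y. hodge_star (\<psi> y)) has_derivative
      (\<lambda>h. hodge_star (frechet_derivative \<psi> (at x) h))) (at x)"
    by (rule bounded_linear.has_derivative[OF bl])
  then show ?thesis
    unfolding partial_def by (simp add: frechet_derivative_at[symmetric])
qed

lemma codiff_component:
  fixes \<psi> :: "('n::{finite,linorder}) dform"
  assumes "\<psi> differentiable (at x)" "card J = p"
  shows "codiff (p + 1) \<psi> x $ J = - (\<Sum>i\<in>- J. shuffle_sign {i} J * (partial i \<psi> x $ insert i J))"
proof -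
  let ?K = "- J" and ?c = "(-1) ^ (CARD('n) * (p + 1 + 1) + 1) :: real"
  have cK: "card ?K + p = CARD('n)"
    using assms(2) by (metis Compl_disjoint card_Un_disjoint Compl_partition finite add.commute)
  have star: "partial i (\<lambda>y. hodge_star (\<psi> y)) x $ (?K - {i}) =
      shuffle_sign (insert i J) (?K - {i}) * (partial i \<psi> x $ insert i J)" for i
  proof -
    have "- (?K - {i}) = insert i J" by auto
    then show ?thesis
      unfolding partial_hodge_star[OF assms(1)] by (simp add: hodge_star_def)
  qed
  have "codiff (p + 1) \<psi> x $ J = ?c * (shuffle_sign ?K J *
      (\<Sum>i\<in>?K. shuffle_sign {i} (?K - {i}) * (partial i (\<lambda>y. hodge_star (\<psi> y)) x $ (?K - {i}))))"
    unfolding codiff_def by (simp add: hodge_star_def[of "ext_deriv _ _"] ext_deriv_component)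
  also have "\<dots> = (\<Sum>i\<in>?K. ?c * shuffle_sign ?K J * shuffle_sign {i} (?K - {i}) *
      shuffle_sign (insert i J) (?K - {i}) * (partial i \<psi> x $ insert i J))"
    unfolding star by (simp add: sum_distrib_left mult_ac)
  also have "\<dots> = (\<Sum>i\<in>?K. - (shuffle_sign {i} J * (partial i \<psi> x $ insert i J)))"
  proof (rule sum.cong[OF refl])
    fix i assume i: "i \<in> ?K"
    let ?L = "?K - {i}"
    have 1: "shuffle_sign (insert i J) ?L = shuffle_sign {i} ?L * shuffle_sign J ?L"
      using shuffle_sign_Un_left[of "{i}" J ?L] i by simp
    have K: "?K = {i} \<union> ?L" using i by auto
    have 2: "shuffle_sign J ?K = shuffle_sign J {i} * shuffle_sign J ?L"
      by (subst K, rule shuffle_sign_Un_right) auto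
    have 3: "shuffle_sign ?K J * shuffle_sign J ?K = (-1) ^ (card ?K * p)"
      using shuffle_sign_commute[of ?K J] assms(2) by auto
    have 4: "shuffle_sign {i} J * shuffle_sign J {i} = (-1) ^ p"
      using shuffle_sign_commute[of "{i}" J] assms(2) i by auto
    have JL: "shuffle_sign J ?L = shuffle_sign J {i} * shuffle_sign J ?K"
      unfolding 2 by (simp flip: mult.assoc)
    have Ji: "shuffle_sign J {i} = (-1) ^ p * shuffle_sign {i} J"
      unfolding 4[symmetric] mult.assoc mult.commute[of "shuffle_sign J {i}" "shuffle_sign {i} J"]
      by (simp flip: mult.assoc)
    have "?c * shuffle_sign ?K J * shuffle_sign {i} ?L * shuffle_sign (insert i J) ?L
        = ?c * shuffle_sign ?K J * (shuffle_sign {i} ?L * shuffle_sign {i} ?L) * shuffle_sign J ?L"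
      unfolding 1 by (simp only: mult_ac)
    also have "\<dots> = ?c * (shuffle_sign ?K J * shuffle_sign J ?K) * shuffle_sign J {i}"
      unfolding JL by simp
    also have "\<dots> = (?c * (-1) ^ (card ?K * p) * (-1) ^ p) * shuffle_sign {i} J"
      unfolding 3 Ji by simp
    also have "?c * (-1) ^ (card ?K * p) * (-1) ^ p = -1"
    proof -
      have "CARD('n) * (p + 1 + 1) + 1 + card ?K * p + p =
          2 * (card ?K * p + card ?K + p) + (p * (p + 1)) + 1"
        unfolding cK[symmetric] by (simp add: algebra_simps)
      then have "odd (CARD('n) * (p + 1 + 1) + 1 + card ?K * p + p)" by simp
      then have "(-1 :: real) ^ (CARD('n) * (p + 1 + 1) + 1 + card ?K * p + p) = -1"
        by (rule neg_one_odd_power)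
      then show ?thesis by (simp only: power_add)
    qed
    finally show "?c * shuffle_sign ?K J * shuffle_sign {i} (?K - {i}) *
        shuffle_sign (insert i J) (?K - {i}) * (partial i \<psi> x $ insert i J)
        = - (shuffle_sign {i} J * (partial i \<psi> x $ insert i J))" by simp
  qed
  finally show ?thesis by (simp add: sum_negf)
qed

lemma integral_partial_zero:
  fixes g :: "('n::finite) pt \<Rightarrow> real"
  assumes op: "open \<Omega>" and C: "compact C" "C \<subseteq> \<Omega>"
    and g: "\<And>x. x \<in> \<Omega> \<Longrightarrow> g differentiable (at x)"
    and cont: "continuous_on \<Omega> (partial i g)"
    and supp: "\<And>x. x \<notin> C \<Longrightarrow> g x = 0"
  shows "(partial i g has_integral 0) \<Omega>"
proof -
  have cl: "open (- C)" using C by (simp add: compact_imp_closed open_Compl)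
  have der0: "(g has_derivative (\<lambda>h. 0)) (at x)" if "x \<notin> C" for x
    by (rule has_derivative_transform_within_open[OF _ cl, of "\<lambda>x. 0"]) (use that supp in auto)
  have p0: "partial i g x = 0" if "x \<notin> C" for x
    unfolding partial_def using frechet_derivative_at[OF der0[OF that]] by metis
  have dg: "g differentiable (at x)" for x
    using g der0 C by (cases "x \<in> C") (auto simp: differentiable_def)
  have "continuous_on (\<Omega> \<union> - C) (partial i g)"
    by (rule continuous_on_open_Un[OF op cl cont])
       (use p0 in \<open>auto intro!: continuous_on_eq[OF continuous_on_const]\<close>)
  moreover have "\<Omega> \<union> - C = UNIV" using C by auto
  ultimately have contp: "continuous_on UNIV (partial i g)" by simp
  have contg: "continuous_on UNIV g"
    using dg by (simp add: continuous_at_imp_continuous_on differentiable_imp_continuous_within)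
  define e where "e = (axis i 1 :: 'n pt)"
  obtain B where B: "C \<subseteq> cball 0 B" 
    using bounded_subset_ballD[OF compact_imp_bounded[OF C(1)], of 0] ball_subset_cball by blast
  obtain a b where ab: "cball (0 :: 'n pt) (B + 1) \<subseteq> cbox a b"
    using bounded_subset_cbox_symmetric[OF bounded_cball] by metis
  have ne: "norm e = 1" by (simp add: e_def)
  define F where "F t = integral (cbox a b) (\<lambda>x. g (x + t *\<^sub>R e))" for t :: real
  have Fconst: "F t = integral UNIV g" if t: "\<bar>t\<bar> \<le> 1" for t
  proof -
    have "F t = integral (cbox (a + t *\<^sub>R e) (b + t *\<^sub>R e)) g"
      unfolding F_def integral_shift_cbox_plus[symmetric] by (simp add: o_def add.commute)
    also have "\<dots> = integral UNIV g"
    proof (rule integral_unique[symmetric], rule has_integral_on_superset)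
      show "(g has_integral integral (cbox (a + t *\<^sub>R e) (b + t *\<^sub>R e)) g)
          (cbox (a + t *\<^sub>R e) (b + t *\<^sub>R e))"
        by (intro integrable_integral integrable_continuous continuous_on_subset[OF contg]) auto
      fix x assume x: "x \<notin> cbox (a + t *\<^sub>R e) (b + t *\<^sub>R e)"
      have "x - t *\<^sub>R e \<notin> cbox a b"
        using x cbox_translation[of "t *\<^sub>R e" a b]
        by (metis add.commute diff_add_cancel image_eqI)
      then have "x - t *\<^sub>R e \<notin> cball 0 (B + 1)" using ab by auto
      then have "B + 1 < norm (x - t *\<^sub>R e)" by simp
      also have "\<dots> \<le> norm x + \<bar>t\<bar>" using norm_triangle_ineq4[of x "t *\<^sub>R e"] ne by simp
      finally have "x \<notin> cball 0 B" using t by simp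
      then show "g x = 0" using B supp by blast
    qed simp
    finally show ?thesis .
  qed
  have leib: "(F has_vector_derivative integral (cbox a b) (\<lambda>x. partial i g (x + 0 *\<^sub>R e)))
      (at 0 within {-1..1})"
    unfolding F_def
  proof (rule leibniz_rule_vector_derivative)
    fix t :: real and x assume "t \<in> {-1..1}" "x \<in> cbox a b"
    have "(g has_derivative frechet_derivative g (at (x + t *\<^sub>R e))) (at (x + t *\<^sub>R e))"
      using dg frechet_derivative_works by blast
    moreover have "((\<lambda>t. x + t *\<^sub>R e) has_derivative (\<lambda>h. h *\<^sub>R e)) (at t within {-1..1})"
      by (auto intro!: derivative_eq_intros)
    ultimately have "((\<lambda>t. g (x + t *\<^sub>R e)) has_derivative
        (\<lambda>h. frechet_derivative g (at (x + t *\<^sub>R e)) (h *\<^sub>R e))) (at t within {-1..1})"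
      by (rule has_derivative_compose[rotated])
    moreover have "linear (frechet_derivative g (at (x + t *\<^sub>R e)))"
      using dg by (rule linear_frechet_derivative)
    ultimately show "((\<lambda>t. g (x + t *\<^sub>R e)) has_vector_derivative partial i g (x + t *\<^sub>R e))
        (at t within {-1..1})"
      by (simp add: has_vector_derivative_def partial_def e_def linear_cmul)
  next
    fix t :: real
    show "(\<lambda>x. g (x + t *\<^sub>R e)) integrable_on cbox a b"
      by (intro integrable_continuous continuous_on_compose2[OF contg] continuous_intros) auto
  next
    show "continuous_on ({-1..1} \<times> cbox a b) (\<lambda>(t, x). partial i g (x + t *\<^sub>R e))"
      unfolding case_prod_beta
      by (intro continuous_on_compose2[OF contp] continuous_intros) auto
  qed auto
  have "at 0 within {-1..1::real} = at 0"
    by (rule at_within_interior) simp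
  then have "(F has_vector_derivative integral (cbox a b) (partial i g)) (at 0)"
    using leib by simp
  moreover have "(F has_vector_derivative 0) (at 0)"
    by (rule has_vector_derivative_transform_within_open[of "\<lambda>_. integral UNIV g" _ _ "{-1<..<1}"])
       (auto simp: Fconst)
  ultimately have "integral (cbox a b) (partial i g) = 0"
    by (rule vector_derivative_unique_at)
  then have "(partial i g has_integral 0) (cbox a b)"
    by (metis contp continuous_on_subset integrable_continuous integrable_integral subset_UNIV)
  moreover have "partial i g x = 0" if "x \<notin> cbox a b" for x
  proof -
    have "cball (0 :: 'n pt) B \<subseteq> cball 0 (B + 1)" by (rule subset_cball) simp
    then have "x \<notin> C" using that ab B by blast
    then show ?thesis by (rule p0)
  qed
  ultimately have "(partial i g has_integral 0) UNIV"
    by (rule has_integral_on_superset) auto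
  moreover have "(if x \<in> \<Omega> then partial i g x else 0) = partial i g x" for x
    using p0[of x] C by auto
  ultimately show ?thesis
    using has_integral_restrict_UNIV[of \<Omega> "partial i g" 0] by simp
qed

text \<open>\<^const>\<open>codiff\<close> is the formal adjoint of \<^const>\<open>ext_deriv\<close>; \<open>\<phi>\<close> is a test form.\<close>

lemma codiff_formal_adjoint:
  fixes \<phi> \<psi> :: "('n::{finite,linorder}) dform"
  assumes op: "open \<Omega>" and C: "compact C" "C \<subseteq> \<Omega>"
    and \<phi>: "form_on p UNIV \<phi>" "Ck_on 1 UNIV \<phi>" and supp: "\<And>x. x \<notin> C \<Longrightarrow> \<phi> x = 0"
    and \<psi>: "Ck_on 1 \<Omega> \<psi>"
  shows "((\<lambda>x. ext_deriv \<phi> x \<bullet> \<psi> x - \<phi> x \<bullet> codiff (p + 1) \<psi> x) has_integral 0) \<Omega>"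
proof -
  let ?g = "\<lambda>i J x. \<phi> x $ J * \<psi> x $ insert i J"
  have d\<phi>: "\<phi> differentiable (at x)" for x using \<phi>(2) by simp
  have d\<psi>: "\<psi> differentiable (at x)" if "x \<in> \<Omega>" for x using \<psi> that by simp
  have cp\<phi>: "continuous_on \<Omega> (partial i \<phi>)" for i
    using \<phi>(2) continuous_on_subset[OF _ subset_UNIV, of "partial i \<phi>" \<Omega>] by simp
  have cp\<psi>: "continuous_on \<Omega> (partial i \<psi>)" for i using \<psi> by simp
  have c\<phi>: "continuous_on \<Omega> \<phi>" and c\<psi>: "continuous_on \<Omega> \<psi>"
    using d\<phi> d\<psi> by (simp_all add: continuous_at_imp_continuous_on differentiable_imp_continuous_within)
  have dg: "(?g i J has_derivative (\<lambda>h. \<phi> x $ J * frechet_derivative \<psi> (at x) h $ insert i J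
      + frechet_derivative \<phi> (at x) h $ J * \<psi> x $ insert i J)) (at x)" if "x \<in> \<Omega>" for i J x
  proof -
    have a: "((\<lambda>x. \<phi> x $ J) has_derivative (\<lambda>h. frechet_derivative \<phi> (at x) h $ J)) (at x)"
      by (rule bounded_linear.has_derivative[OF bounded_linear_vec_nth])
         (use d\<phi> frechet_derivative_works in blast)
    have b: "((\<lambda>x. \<psi> x $ insert i J) has_derivative (\<lambda>h. frechet_derivative \<psi> (at x) h $ insert i J)) (at x)"
      by (rule bounded_linear.has_derivative[OF bounded_linear_vec_nth])
         (use d\<psi>[OF that] frechet_derivative_works in blast)
    show ?thesis by (rule has_derivative_mult[OF a b])
  qed
  have pg: "partial j (?g i J) x = \<phi> x $ J * (partial j \<psi> x $ insert i J)
      + (partial j \<phi> x $ J) * \<psi> x $ insert i J" if "x \<in> \<Omega>" for i J j x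
    unfolding partial_def[of j "?g i J"] frechet_derivative_at[OF dg[OF that], symmetric]
    by (simp add: partial_def)
  have int0: "(partial i (?g i J) has_integral 0) \<Omega>" for i J
  proof (rule integral_partial_zero[OF op C])
    show "?g i J differentiable (at x)" if "x \<in> \<Omega>" for x
      using dg[OF that] by (rule differentiableI)
    have "continuous_on \<Omega> (\<lambda>x. \<phi> x $ J * (partial i \<psi> x $ insert i J)
        + (partial i \<phi> x $ J) * \<psi> x $ insert i J)"
      by (intro continuous_intros c\<phi> c\<psi> cp\<phi> cp\<psi>)
    then show "continuous_on \<Omega> (partial i (?g i J))"
      by (rule continuous_on_eq) (simp add: pg)
    show "?g i J x = 0" if "x \<notin> C" for x using supp[OF that] by simp
  qed
  have partial0: "partial i \<phi> x $ J = 0" if "card J \<noteq> p" for i x J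
  proof -
    have "((\<lambda>x. \<phi> x $ J) has_derivative (\<lambda>h. frechet_derivative \<phi> (at x) h $ J)) (at x)"
      by (rule bounded_linear.has_derivative[OF bounded_linear_vec_nth])
         (use d\<phi> frechet_derivative_works in blast)
    moreover have "(\<lambda>x. \<phi> x $ J) = (\<lambda>x. 0)"
      using \<phi>(1) that by (simp add: form_on_def homogeneous_def)
    ultimately have "(\<lambda>h. frechet_derivative \<phi> (at x) h $ J) = (\<lambda>h. 0)"
      by (metis has_derivative_const has_derivative_unique)
    then show ?thesis unfolding partial_def by metis
  qed
  have key: "ext_deriv \<phi> x \<bullet> \<psi> x - \<phi> x \<bullet> codiff (p + 1) \<psi> x =
      (\<Sum>J\<in>UNIV. \<Sum>i\<in>- J. shuffle_sign {i} J * partial i (?g i J) x)" if x: "x \<in> \<Omega>" for x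
  proof -
    let ?h = "\<lambda>J i. shuffle_sign {i} J * (partial i \<phi> x $ J) * (\<psi> x $ insert i J)"
    have "ext_deriv \<phi> x \<bullet> \<psi> x = (\<Sum>K\<in>UNIV. \<Sum>i\<in>K. ?h (K - {i}) i)"
      by (simp add: inner_vec_def ext_deriv_component sum_distrib_right insert_absorb)
    also have "\<dots> = (\<Sum>(K, i)\<in>Sigma UNIV (\<lambda>K. K). ?h (K - {i}) i)"
      by (simp add: sum.Sigma)
    also have "\<dots> = (\<Sum>(J, i)\<in>Sigma UNIV (\<lambda>J. - J). ?h J i)"
      by (rule sum.reindex_bij_witness[of _ "\<lambda>(J, i). (insert i J, i)" "\<lambda>(K, i). (K - {i}, i)"])
         auto
    also have "\<dots> = (\<Sum>J\<in>UNIV. \<Sum>i\<in>- J. ?h J i)"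
      by (simp add: sum.Sigma)
    finally have 1: "ext_deriv \<phi> x \<bullet> \<psi> x = (\<Sum>J\<in>UNIV. \<Sum>i\<in>- J. ?h J i)" .
    have "\<phi> x $ J * codiff (p + 1) \<psi> x $ J =
        - (\<Sum>i\<in>- J. shuffle_sign {i} J * (\<phi> x $ J * (partial i \<psi> x $ insert i J)))" for J
    proof (cases "card J = p")
      case True
      then show ?thesis
        by (simp only: codiff_component[OF d\<psi>[OF x] True])
           (simp add: sum_distrib_left mult_ac)
    next
      case False
      then have "\<phi> x $ J = 0" using \<phi>(1) by (simp add: form_on_def homogeneous_def)
      then show ?thesis by simp
    qed
    then have 2: "\<phi> x \<bullet> codiff (p + 1) \<psi> x =
        - (\<Sum>J\<in>UNIV. \<Sum>i\<in>- J. shuffle_sign {i} J * (\<phi> x $ J * (partial i \<psi> x $ insert i J)))"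
      by (simp add: inner_vec_def sum_negf)
    show ?thesis
      unfolding 1 2 pg[OF x] by (simp add: algebra_simps sum.distrib)
  qed
  have "((\<lambda>x. \<Sum>J\<in>UNIV. \<Sum>i\<in>- J. shuffle_sign {i} J * partial i (?g i J) x) has_integral
      (\<Sum>J\<in>(UNIV :: 'n set set). \<Sum>i\<in>- J. shuffle_sign {i} J * 0)) \<Omega>"
    by (intro has_integral_sum has_integral_mult_right int0) auto
  then show ?thesis
    by (subst has_integral_cong[OF key]) simp_all
qed


section \<open>Smooth domains\<close>

text \<open>Near each boundary point, \<open>\<Omega>\<close> is a strict sublevel set of a smooth function with
  nonvanishing gradient.\<close>

definition smooth_domain :: "('n::finite) pt set \<Rightarrow> bool" where
  "smooth_domain \<Omega> \<longleftrightarrow> open \<Omega> \<and> connected \<Omega> \<and> \<Omega> \<noteq> {} \<and>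
     (\<forall>p\<in>frontier \<Omega>. \<exists>U (g :: 'n pt \<Rightarrow> real).
        open U \<and> p \<in> U \<and> (\<forall>m. Ck_on m U g) \<and> (\<exists>i. partial i g p \<noteq> 0) \<and>
        \<Omega> \<inter> U = {x\<in>U. g x < 0})"


section \<open>Mass densities and the nonlinear Hodge systems\<close>

text \<open>
  A density is a function \<open>\<rho> x Q\<close> of the point and of \<open>Q \<ge> 0\<close>.  No regularity is built in:
  solutions carry the regularity they need, and the derivative in \<open>Q\<close> is part of ellipticity.
  A density which is naturally given only for some values of \<open>Q\<close> can hence be extended by any
  positive values, without effect on solutions with values of \<open>Q\<close> in the original range.
\<close>

type_synonym 'n density = "'n pt \<Rightarrow> real \<Rightarrow> real"

definition mass_density :: "('n::finite) pt set \<Rightarrow> 'n density \<Rightarrow> bool" where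
  "mass_density \<Omega> \<rho> \<longleftrightarrow> (\<forall>x\<in>\<Omega>. \<forall>Q\<ge>0. 0 < \<rho> x Q)"

definition C1_density :: "('n::finite) pt set \<Rightarrow> 'n density \<Rightarrow> bool" where
  "C1_density \<Omega> \<rho> \<longleftrightarrow> (\<exists>D :: 'n pt \<times> real \<Rightarrow> ('n pt \<times> real) \<Rightarrow>\<^sub>L real.
     (\<forall>p\<in>\<Omega> \<times> {0..}. ((\<lambda>(x, Q). \<rho> x Q) has_derivative blinfun_apply (D p)) (at p within \<Omega> \<times> {0..}))
     \<and> continuous_on (\<Omega> \<times> {0..}) D)"

text \<open>The derivative in \<open>Q\<close> is one-sided at \<open>Q = 0\<close>.\<close>

definition elliptic_at :: "('n::finite) density \<Rightarrow> 'n pt \<Rightarrow> real \<Rightarrow> bool" where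
  "elliptic_at \<rho> x Q \<longleftrightarrow>
     (\<exists>\<rho>'. (\<rho> x has_real_derivative \<rho>') (at Q within {0..}) \<and>
           0 < (\<rho> x Q)\<^sup>2 + 2 * Q * \<rho>' * \<rho> x Q)"

definition elliptic :: "('n::finite) pt set \<Rightarrow> 'n density \<Rightarrow> bool" where
  "elliptic \<Omega> \<rho> \<longleftrightarrow> (\<forall>x\<in>\<Omega>. \<forall>Q\<ge>0. elliptic_at \<rho> x Q)"

definition flux :: "('n::{finite,linorder}) density \<Rightarrow> 'n dform \<Rightarrow> 'n dform" where
  "flux \<rho> \<omega> x = \<rho> x (norm_sq (\<omega> x)) *\<^sub>R \<omega> x"

text \<open>In both systems a classical solution is a \<open>C^1\<close> form with \<open>C^1\<close> flux which satisfies the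
  equations pointwise.\<close>

definition hodge_frobenius_solution ::
  "nat \<Rightarrow> ('n::{finite,linorder}) pt set \<Rightarrow> 'n density \<Rightarrow> 'n dform \<Rightarrow> 'n dform \<Rightarrow> 'n dform \<Rightarrow> bool"
where
  "hodge_frobenius_solution k \<Omega> \<rho> \<Sigma> \<Gamma> \<omega> \<longleftrightarrow>
     form_on k \<Omega> \<omega> \<and> Ck_on 1 \<Omega> \<omega> \<and> Ck_on 1 \<Omega> (flux \<rho> \<omega>) \<and>
     (\<forall>x\<in>\<Omega>. ext_deriv (\<lambda>y. hodge_star (flux \<rho> \<omega> y)) x = \<Sigma> x \<and>\<^sub>w hodge_star (flux \<rho> \<omega> x) \<and>
             ext_deriv \<omega> x = \<Gamma> x \<and>\<^sub>w \<omega> x)"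

definition nonlinear_hodge_solution ::
  "nat \<Rightarrow> ('n::{finite,linorder}) pt set \<Rightarrow> 'n density \<Rightarrow> 'n dform \<Rightarrow> bool" where
  "nonlinear_hodge_solution k \<Omega> \<rho> \<omega> \<longleftrightarrow>
     form_on k \<Omega> \<omega> \<and> Ck_on 1 \<Omega> \<omega> \<and> Ck_on 1 \<Omega> (flux \<rho> \<omega>) \<and>
     (\<forall>x\<in>\<Omega>. codiff k (flux \<rho> \<omega>) x = 0 \<and> ext_deriv \<omega> x = 0)"

definition conformal_factor :: "('n::finite) pt set \<Rightarrow> ('n pt \<Rightarrow> real) \<Rightarrow> bool" where
  "conformal_factor \<Omega> \<mu> \<longleftrightarrow> Ck_on 1 \<Omega> \<mu> \<and> (\<forall>x\<in>\<Omega>. 0 < \<mu> x)"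

definition conformally_related ::
  "('n::finite) pt set \<Rightarrow> ('n pt \<Rightarrow> real) \<Rightarrow> 'n dform \<Rightarrow> 'n dform \<Rightarrow> bool" where
  "conformally_related \<Omega> \<mu> \<omega>\<^sub>1 \<omega>\<^sub>0 \<longleftrightarrow> (\<forall>x\<in>\<Omega>. \<omega>\<^sub>0 x = \<mu> x *\<^sub>R \<omega>\<^sub>1 x)"

text \<open>
  The system with density \<open>\<rho>\<^sub>1\<close> and coefficients \<open>\<Sigma>\<close>, \<open>\<Gamma>\<close> and the system with density \<open>\<rho>\<^sub>0\<close> and
  zero coefficients have the same classical \<open>k\<close>-form solutions up to a \<open>C^1\<close> conformal factor,
  and ellipticity holds on one side iff it holds on the other, for the densities as well as along
  corresponding solutions.  The last clause expresses that passing between \<open>\<rho>\<^sub>1\<close> and \<open>\<rho>\<^sub>0\<close> does not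
  leave the class of \<open>C^1\<close> densities.
\<close>

definition conformal_correspondence ::
  "nat \<Rightarrow> ('n::{finite,linorder}) pt set \<Rightarrow> 'n dform \<Rightarrow> 'n dform \<Rightarrow> 'n density \<Rightarrow> 'n density \<Rightarrow> bool"
where
  "conformal_correspondence k \<Omega> \<Sigma> \<Gamma> \<rho>\<^sub>1 \<rho>\<^sub>0 \<longleftrightarrow>
     (\<exists>\<mu>. conformal_factor \<Omega> \<mu> \<and>
       (\<forall>\<omega>\<^sub>1. hodge_frobenius_solution k \<Omega> \<rho>\<^sub>1 \<Sigma> \<Gamma> \<omega>\<^sub>1 \<longrightarrow>
          (\<exists>\<omega>\<^sub>0. nonlinear_hodge_solution k \<Omega> \<rho>\<^sub>0 \<omega>\<^sub>0 \<and> conformally_related \<Omega> \<mu> \<omega>\<^sub>1 \<omega>\<^sub>0)) \<and>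
       (\<forall>\<omega>\<^sub>0. nonlinear_hodge_solution k \<Omega> \<rho>\<^sub>0 \<omega>\<^sub>0 \<longrightarrow>
          (\<exists>\<omega>\<^sub>1. hodge_frobenius_solution k \<Omega> \<rho>\<^sub>1 \<Sigma> \<Gamma> \<omega>\<^sub>1 \<and> conformally_related \<Omega> \<mu> \<omega>\<^sub>1 \<omega>\<^sub>0)) \<and>
       (\<forall>\<omega>\<^sub>1 \<omega>\<^sub>0. conformally_related \<Omega> \<mu> \<omega>\<^sub>1 \<omega>\<^sub>0 \<longrightarrow>
          (\<forall>x\<in>\<Omega>. elliptic_at \<rho>\<^sub>1 x (norm_sq (\<omega>\<^sub>1 x)) \<longleftrightarrow> elliptic_at \<rho>\<^sub>0 x (norm_sq (\<omega>\<^sub>0 x))))) \<and>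
     (elliptic \<Omega> \<rho>\<^sub>1 \<longleftrightarrow> elliptic \<Omega> \<rho>\<^sub>0) \<and>
     (C1_density \<Omega> \<rho>\<^sub>1 \<longleftrightarrow> C1_density \<Omega> \<rho>\<^sub>0)"

end

theory Submission
  imports Defs
begin

text \<open>
  Multiplying a form by \<open>exp \<phi>\<close> and its flux by \<open>exp \<psi>\<close> adds \<open>d\<phi>\<close> to \<open>\<Gamma>\<close> and \<open>d\<psi>\<close> to \<open>\<Sigma>\<close>, by
  the Leibniz rule.  The rescaled form has the rescaled flux exactly for the density
  \<open>exp (\<psi> - \<phi>) \<cdot> \<rho> x (exp (- 2 \<phi>) \<cdot> Q)\<close>.  The choice \<open>\<phi> = - \<eta>\<close>, \<open>\<psi> = - \<zeta>\<close> removes both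
  coefficients, and the rescalings by \<open>(\<phi>, \<psi>)\<close> and \<open>(- \<phi>, - \<psi>)\<close> are inverse to each other, so each
  property needs to be transported in one direction only.
\<close>

section \<open>The Leibniz rule\<close>

lemma wedge_add_right: "a \<and>\<^sub>w (b + c) = a \<and>\<^sub>w b + a \<and>\<^sub>w c"
  by (simp add: wedge_def vec_eq_iff algebra_simps sum.distrib)

lemma wedge_add_left: "(a + b) \<and>\<^sub>w c = a \<and>\<^sub>w c + b \<and>\<^sub>w c"
  by (simp add: wedge_def vec_eq_iff algebra_simps sum.distrib)

lemma wedge_scaleR_right: "a \<and>\<^sub>w (r *\<^sub>R b) = r *\<^sub>R (a \<and>\<^sub>w b)"
  by (simp add: wedge_def vec_eq_iff algebra_simps sum_distrib_left)

lemma wedge_scaleR_left: "(r *\<^sub>R a) \<and>\<^sub>w b = r *\<^sub>R (a \<and>\<^sub>w b)"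
  by (simp add: wedge_def vec_eq_iff algebra_simps sum_distrib_left)

lemma wedge_zero_left: "0 \<and>\<^sub>w b = 0"
  by (simp add: wedge_def vec_eq_iff)

lemma wedge_sum_left: "(\<Sum>i\<in>A. a i) \<and>\<^sub>w b = (\<Sum>i\<in>A. a i \<and>\<^sub>w b)"
  by (induction A rule: infinite_finite_induct) (simp_all add: wedge_zero_left wedge_add_left)

lemma shuffle_sign_empty_right: "shuffle_sign K {} = 1"
  by (simp add: shuffle_sign_def)

text \<open>Scalars sit at the index \<open>{}\<close>, so among the subsets of \<open>K\<close>
  only \<open>I = K\<close> contributes, with trivial sign.\<close>

lemma wedge_axis_empty: "a \<and>\<^sub>w axis {} r = r *\<^sub>R a"
proof -
  have "(\<Sum>I\<in>Pow K. shuffle_sign I (K - I) * a $ I * axis {} r $ (K - I)) =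
      (\<Sum>I\<in>Pow K. if I = K then r * a $ K else 0)" for K
    by (rule sum.cong[OF refl]) (auto simp: axis_def shuffle_sign_empty_right)
  then show ?thesis
    by (simp add: wedge_def vec_eq_iff)
qed

lemma hodge_star_scaleR: "hodge_star (r *\<^sub>R a) = r *\<^sub>R hodge_star a"
  by (simp add: hodge_star_def vec_eq_iff)

text \<open>The star permutes the components up to sign, hence is injective. This removes the outer
  star of \<open>codiff\<close> from an equation with zero right-hand side.\<close>

lemma hodge_star_eq_0_iff: "hodge_star a = 0 \<longleftrightarrow> a = 0"
proof
  assume *: "hodge_star a = 0"
  have "a $ K = 0" for K
  proof -
    have "hodge_star a $ (- K) = 0" using * by simp
    then show ?thesis by (simp add: hodge_star_def shuffle_sign_def)
  qed
  then show "a = 0" by (simp add: vec_eq_iff)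
qed (simp add: hodge_star_def vec_eq_iff)

lemma norm_sq_scaleR: "norm_sq (r *\<^sub>R a) = r\<^sup>2 * norm_sq a"
  by (simp add: norm_sq_eq_inner power2_eq_square)

section \<open>Rules for partial derivatives, the differential and the exterior derivative\<close>

text \<open>Uniqueness of the derivative identifies the one chosen by
  \<open>frechet_derivative\<close>, so the rules for \<open>partial\<close> reduce to those for
  \<open>has_derivative\<close>.\<close>

lemma partial_eqI: "(f has_derivative f') (at x) \<Longrightarrow> partial i f x = f' (axis i 1)"
  unfolding partial_def by (simp add: frechet_derivative_at[symmetric])

lemma partial_add:
  assumes "f differentiable (at x)" "g differentiable (at x)"
  shows "partial i (\<lambda>y. f y + g y) x = partial i f x + partial i g x"
  using partial_eqI[OF has_derivative_add[OF assms[unfolded frechet_derivative_works]]]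
  by (simp add: partial_def)

lemma partial_uminus:
  assumes "f differentiable (at x)"
  shows "partial i (\<lambda>y. - f y) x = - partial i f x"
  using partial_eqI[OF has_derivative_minus[OF assms[unfolded frechet_derivative_works]]]
  by (simp add: partial_def)

lemma partial_exp:
  assumes "f differentiable (at x)"
  shows "partial i (\<lambda>y. exp (f y) :: real) x = exp (f x) * partial i f x"
  using partial_eqI[OF has_derivative_exp[OF assms[unfolded frechet_derivative_works]]]
  by (simp add: partial_def)

lemma partial_scaleR:
  assumes "f differentiable (at x)" "\<omega> differentiable (at x)"
  shows "partial i (\<lambda>y. f y *\<^sub>R \<omega> y) x = f x *\<^sub>R partial i \<omega> x + partial i f x *\<^sub>R \<omega> x"
  using partial_eqI[OF has_derivative_scaleR[OF assms[unfolded frechet_derivative_works]]]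
  by (simp add: partial_def)

text \<open>Embedding scalars as 0-covectors is bounded linear, so it commutes with partial
  derivatives; wedging with a 0-covector is scaling.\<close>

lemma differential_eq:
  assumes "f differentiable (at x)"
  shows "differential f x = (\<Sum>i\<in>UNIV. partial i f x *\<^sub>R axis {i} 1)"
proof -
  have bl: "bounded_linear (axis {} :: real \<Rightarrow> 'a ext)"
    by (simp add: linear_conv_bounded_linear[symmetric] linear_iff vec_eq_iff axis_def)
  have "partial i (zero_form f) x = axis {} (partial i f x)" for i
    using partial_eqI[OF bounded_linear.has_derivative[OF bl
        assms[unfolded frechet_derivative_works]]]
    by (simp add: partial_def zero_form_def[abs_def])
  then show ?thesis
    by (simp add: differential_def ext_deriv_def wedge_axis_empty)
qed

text \<open>The product rule holds for each partial derivative; the terms in which \<open>f\<close>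
  is differentiated collect into the differential of \<open>f\<close> wedged with
  \<open>\<omega> x\<close>.\<close>

lemma ext_deriv_scaleR:
  assumes "f differentiable (at x)" "\<omega> differentiable (at x)"
  shows "ext_deriv (\<lambda>y. f y *\<^sub>R \<omega> y) x = f x *\<^sub>R ext_deriv \<omega> x + differential f x \<and>\<^sub>w \<omega> x"
  unfolding ext_deriv_def differential_eq[OF assms(1)] partial_scaleR[OF assms]
  by (simp add: wedge_add_right wedge_scaleR_right wedge_scaleR_left wedge_sum_left
      sum.distrib scaleR_sum_right)

lemma differential_add:
  assumes "f differentiable (at x)" "g differentiable (at x)"
  shows "differential (\<lambda>y. f y + g y) x = differential f x + differential g x"
  using assms
  by (simp add: differential_eq differentiable_add partial_add scaleR_add_left sum.distrib)

lemma differentiable_exp: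
  fixes f :: "'a::real_normed_vector \<Rightarrow> real"
  shows "f differentiable (at x) \<Longrightarrow> (\<lambda>y. exp (f y)) differentiable (at x)"
  unfolding differentiable_def by (blast intro: has_derivative_exp)

lemma differential_exp:
  assumes "f differentiable (at x)"
  shows "differential (\<lambda>y. exp (f y)) x = exp (f x) *\<^sub>R differential f x"
  using assms by (simp add: differential_eq differentiable_exp partial_exp scaleR_sum_right)

lemma differential_zero: "differential (\<lambda>x. 0) x = 0"
proof -
  have "partial i (\<lambda>x. 0 :: real) x = 0" for i
    by (rule partial_eqI[OF has_derivative_const])
  then show ?thesis by (simp add: differential_eq)
qed

text \<open>Since d(exp f) = exp f df, every term of the Leibniz rule carries the factor exp f, and
  the equation keeps its shape while its coefficient gains df.\<close>

lemma ext_deriv_exp_scaleR: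
  assumes "f differentiable (at x)" "g differentiable (at x)" "\<omega> differentiable (at x)"
    and "ext_deriv \<omega> x = differential g x \<and>\<^sub>w \<omega> x"
  shows "ext_deriv (\<lambda>y. exp (f y) *\<^sub>R \<omega> y) x =
    differential (\<lambda>y. g y + f y) x \<and>\<^sub>w (exp (f x) *\<^sub>R \<omega> x)"
  using assms
  by (simp add: ext_deriv_scaleR differentiable_exp differential_exp differential_add
      wedge_add_left wedge_scaleR_left wedge_scaleR_right scaleR_add_right)

section \<open>Functions of class C1\<close>

lemma Ck_on_1_continuous: "Ck_on 1 S f \<Longrightarrow> continuous_on S f"
  by (simp add: continuous_at_imp_continuous_on differentiable_imp_continuous_within)

lemma Ck_on_1_uminus:
  assumes "Ck_on 1 S f"
  shows "Ck_on 1 S (\<lambda>x. - f x)"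
proof -
  have "continuous_on S (\<lambda>x. - partial i f x)" for i
    using assms by (intro continuous_intros) simp
  \<comment> \<open>The formula for the partial derivative is available on \<open>S\<close>, so
    continuity is transferred by equality on \<open>S\<close>.\<close>
  then have "continuous_on S (partial i (\<lambda>x. - f x))" for i
    by (rule continuous_on_eq) (use assms in \<open>simp add: partial_uminus\<close>)
  then show ?thesis using assms by simp
qed

lemma Ck_on_1_exp:
  fixes f :: "('n::finite) pt \<Rightarrow> real"
  assumes "Ck_on 1 S f"
  shows "Ck_on 1 S (\<lambda>x. exp (f x))"
proof -
  have "continuous_on S (\<lambda>x. exp (f x) * partial i f x)" for i
    using assms Ck_on_1_continuous[OF assms] by (intro continuous_intros) simp_all
  then have "continuous_on S (partial i (\<lambda>x. exp (f x)))" for i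
    by (rule continuous_on_eq) (use assms in \<open>simp add: partial_exp\<close>)
  then show ?thesis using assms by (simp add: differentiable_exp)
qed

lemma Ck_on_1_scaleR:
  fixes f :: "('n::finite) pt \<Rightarrow> real"
  assumes "Ck_on 1 S f" "Ck_on 1 S g"
  shows "Ck_on 1 S (\<lambda>x. f x *\<^sub>R g x)"
proof -
  have "continuous_on S (\<lambda>x. f x *\<^sub>R partial i g x + partial i f x *\<^sub>R g x)" for i
    using assms assms[THEN Ck_on_1_continuous] by (intro continuous_intros) simp_all
  then have "continuous_on S (partial i (\<lambda>x. f x *\<^sub>R g x))" for i
    by (rule continuous_on_eq) (use assms in \<open>simp add: partial_scaleR\<close>)
  then show ?thesis using assms by (simp add: differentiable_scaleR)
qed

section \<open>Continuously differentiable maps relative to a set\<close>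

text \<open>The shape of \<open>C1_density\<close>, freed from its particular domain. Derivatives
  are taken within \<open>S\<close>, which covers boundary points such as \<open>Q = 0\<close>;
  within a general set they need not be unique, whence the quantifier over \<open>D\<close>.\<close>

definition C1_map_on :: "'a::real_normed_vector set \<Rightarrow> ('a \<Rightarrow> 'b::real_normed_vector) \<Rightarrow> bool" where
  "C1_map_on S f \<longleftrightarrow> (\<exists>D :: 'a \<Rightarrow> 'a \<Rightarrow>\<^sub>L 'b.
     (\<forall>x\<in>S. (f has_derivative blinfun_apply (D x)) (at x within S)) \<and> continuous_on S D)"

lemma C1_map_onI:
  assumes "\<And>x. x \<in> S \<Longrightarrow> (f has_derivative blinfun_apply (D x)) (at x within S)"
    and "continuous_on S D"
  shows "C1_map_on S f"
  using assms unfolding C1_map_on_def by blast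

lemma C1_map_onE:
  assumes "C1_map_on S f"
  obtains D where "\<And>x. x \<in> S \<Longrightarrow> (f has_derivative blinfun_apply (D x)) (at x within S)"
    and "continuous_on S D"
  using assms unfolding C1_map_on_def by blast

lemma C1_density_iff: "C1_density \<Omega> \<rho> \<longleftrightarrow> C1_map_on (\<Omega> \<times> {0..}) (\<lambda>(x, Q). \<rho> x Q)"
  by (simp add: C1_density_def C1_map_on_def)

lemma C1_map_on_continuous: "C1_map_on S f \<Longrightarrow> continuous_on S f"
  by (auto simp: C1_map_on_def continuous_on_eq_continuous_within intro: has_derivative_continuous)

lemma C1_map_on_bounded_linear:
  assumes "bounded_linear f"
  shows "C1_map_on S f"
  by (rule C1_map_onI[of _ _ "\<lambda>_. Blinfun f"])
     (use assms in \<open>auto simp: bounded_linear_Blinfun_apply bounded_linear_imp_has_derivative\<close>)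

lemma C1_map_on_compose:
  assumes "C1_map_on T g" "C1_map_on S f" "f ` S \<subseteq> T"
  shows "C1_map_on S (\<lambda>x. g (f x))"
proof -
  obtain E where E: "\<And>y. y \<in> T \<Longrightarrow> (g has_derivative blinfun_apply (E y)) (at y within T)"
    and cE: "continuous_on T E" using C1_map_onE[OF assms(1)] by metis
  obtain D where D: "\<And>x. x \<in> S \<Longrightarrow> (f has_derivative blinfun_apply (D x)) (at x within S)"
    and cD: "continuous_on S D" using C1_map_onE[OF assms(2)] by metis
  show ?thesis
  proof (rule C1_map_onI[of _ _ "\<lambda>x. E (f x) o\<^sub>L D x"])
    fix x assume x: "x \<in> S"
    \<comment> \<open>The chain rule asks for the derivative of \<open>g\<close> relative to the
      image of \<open>S\<close>; restriction from \<open>T\<close> provides it.\<close>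
    have "(g has_derivative blinfun_apply (E (f x))) (at (f x) within f ` S)"
      using E x assms(3) by (blast intro: has_derivative_subset)
    from has_derivative_in_compose[OF D[OF x] this]
    show "((\<lambda>x. g (f x)) has_derivative blinfun_apply (E (f x) o\<^sub>L D x)) (at x within S)"
      by (simp add: blinfun_apply_blinfun_compose[abs_def] comp_def)
  next
    have "continuous_on S (\<lambda>x. E (f x))"
      using continuous_on_compose2[OF cE C1_map_on_continuous[OF assms(2)] assms(3)] .
    then show "continuous_on S (\<lambda>x. E (f x) o\<^sub>L D x)"
      by (intro bounded_bilinear.continuous_on[OF bounded_bilinear_blinfun_compose] cD)
  qed
qed

lemma C1_map_on_mult:
  fixes f g :: "'a::real_normed_vector \<Rightarrow> real"
  assumes "C1_map_on S f" "C1_map_on S g"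
  shows "C1_map_on S (\<lambda>x. f x * g x)"
proof -
  obtain D where D: "\<And>x. x \<in> S \<Longrightarrow> (f has_derivative blinfun_apply (D x)) (at x within S)"
    and cD: "continuous_on S D" using C1_map_onE[OF assms(1)] by metis
  obtain E where E: "\<And>x. x \<in> S \<Longrightarrow> (g has_derivative blinfun_apply (E x)) (at x within S)"
    and cE: "continuous_on S E" using C1_map_onE[OF assms(2)] by metis
  show ?thesis
  proof (rule C1_map_onI[of _ _ "\<lambda>x. f x *\<^sub>R E x + g x *\<^sub>R D x"])
    fix x assume x: "x \<in> S"
    show "((\<lambda>x. f x * g x) has_derivative blinfun_apply (f x *\<^sub>R E x + g x *\<^sub>R D x)) (at x within S)"
      using has_derivative_mult[OF D[OF x] E[OF x]]
      by (rule has_derivative_eq_rhs) (simp add: fun_eq_iff blinfun.bilinear_simps)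
  next
    show "continuous_on S (\<lambda>x. f x *\<^sub>R E x + g x *\<^sub>R D x)"
      using assms by (intro continuous_intros cD cE C1_map_on_continuous)
  qed
qed

lemma C1_map_on_Pair:
  fixes f :: "'a::real_normed_vector \<Rightarrow> 'b::real_normed_vector" and g :: "'a \<Rightarrow> 'c::real_normed_vector"
  assumes "C1_map_on S f" "C1_map_on S g"
  shows "C1_map_on S (\<lambda>x. (f x, g x))"
proof -
  obtain D where D: "\<And>x. x \<in> S \<Longrightarrow> (f has_derivative blinfun_apply (D x)) (at x within S)"
    and cD: "continuous_on S D" using C1_map_onE[OF assms(1)] by metis
  obtain E where E: "\<And>x. x \<in> S \<Longrightarrow> (g has_derivative blinfun_apply (E x)) (at x within S)"
    and cE: "continuous_on S E" using C1_map_onE[OF assms(2)] by metis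
  \<comment> \<open>The derivative of the pair is assembled from the two injections into the
    product, so that its continuity in \<open>x\<close> follows from that of operator
    composition.\<close>
  let ?P = "Blinfun (\<lambda>u. (u, 0)) :: 'b \<Rightarrow>\<^sub>L ('b \<times> 'c)" and ?R = "Blinfun (Pair 0) :: 'c \<Rightarrow>\<^sub>L ('b \<times> 'c)"
  have bl: "bounded_linear (\<lambda>u :: 'b. (u, 0 :: 'c))" "bounded_linear (Pair (0 :: 'b) :: 'c \<Rightarrow> _)"
    by (intro bounded_linear_Pair bounded_linear_ident bounded_linear_zero)+
  show ?thesis
  proof (rule C1_map_onI[of _ _ "\<lambda>x. (?P o\<^sub>L D x) + (?R o\<^sub>L E x)"])
    fix x assume x: "x \<in> S"
    show "((\<lambda>x. (f x, g x)) has_derivative blinfun_apply ((?P o\<^sub>L D x) + (?R o\<^sub>L E x)))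
        (at x within S)"
      using has_derivative_Pair[OF D[OF x] E[OF x]]
      by (rule has_derivative_eq_rhs)
         (simp add: fun_eq_iff blinfun.add_left bounded_linear_Blinfun_apply[OF bl(1)]
           bounded_linear_Blinfun_apply[OF bl(2)])
  next
    show "continuous_on S (\<lambda>x. (?P o\<^sub>L D x) + (?R o\<^sub>L E x))"
      by (intro continuous_on_add continuous_on_const cD cE
          bounded_bilinear.continuous_on[OF bounded_bilinear_blinfun_compose])
  qed
qed

text \<open>The derivative is the finite combination of the coordinate functionals with the partial
  derivatives as coefficients, so continuity of these gives continuity in the operator norm.\<close>

lemma C1_map_on_Ck_on:
  fixes f :: "('n::finite) pt \<Rightarrow> real"
  assumes "Ck_on 1 S f"
  shows "C1_map_on S f"
proof (rule C1_map_onI[of _ _ "\<lambda>x. \<Sum>i\<in>UNIV. partial i f x *\<^sub>R Blinfun (\<lambda>h. h $ i)"])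
  fix x assume "x \<in> S"
  then have d: "(f has_derivative frechet_derivative f (at x)) (at x)"
    using assms by (simp add: frechet_derivative_works)
  then have lin: "linear (frechet_derivative f (at x))" by (rule has_derivative_linear)
  have "frechet_derivative f (at x) h = (\<Sum>i\<in>UNIV. partial i f x * h $ i)" for h
  proof -
    have "frechet_derivative f (at x) h = frechet_derivative f (at x) (\<Sum>i\<in>UNIV. h $ i *\<^sub>R axis i 1)"
      using basis_expansion[of h] by (simp add: scalar_mult_eq_scaleR)
    then show ?thesis
      by (simp add: linear_sum[OF lin] linear_scale[OF lin] partial_def mult.commute)
  qed
  then have "frechet_derivative f (at x) =
      blinfun_apply (\<Sum>i\<in>UNIV. partial i f x *\<^sub>R Blinfun (\<lambda>h. h $ i))"
    by (simp add: fun_eq_iff blinfun.sum_left blinfun.scaleR_left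
        bounded_linear_Blinfun_apply bounded_linear_vec_nth)
  then show "(f has_derivative blinfun_apply (\<Sum>i\<in>UNIV. partial i f x *\<^sub>R Blinfun (\<lambda>h. h $ i)))
      (at x within S)"
    using d by (simp add: has_derivative_at_withinI)
next
  show "continuous_on S (\<lambda>x. \<Sum>i\<in>UNIV. partial i f x *\<^sub>R (Blinfun (\<lambda>h. h $ i) :: 'n pt \<Rightarrow>\<^sub>L real))"
    using assms by (intro continuous_intros) simp
qed

section \<open>Conformal rescaling\<close>

definition rescale :: "('n::finite pt \<Rightarrow> real) \<Rightarrow> ('n pt \<Rightarrow> real) \<Rightarrow> 'n density \<Rightarrow> 'n density" where
  "rescale \<phi> \<psi> \<rho> x Q = exp (\<psi> x - \<phi> x) * \<rho> x (exp (- 2 * \<phi> x) * Q)"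

text \<open>The exponents of successive rescalings add up, so opposite ones cancel.\<close>

lemma rescale_inverse: "rescale (\<lambda>x. - \<phi> x) (\<lambda>x. - \<psi> x) (rescale \<phi> \<psi> \<rho>) = \<rho>"
proof (intro ext)
  fix x Q
  have "exp (- 2 * \<phi> x) * (exp (- 2 * - \<phi> x) * Q) = Q"
    by (simp flip: mult.assoc exp_add)
  then show "rescale (\<lambda>x. - \<phi> x) (\<lambda>x. - \<psi> x) (rescale \<phi> \<psi> \<rho>) x Q = \<rho> x Q"
    unfolding rescale_def by (simp flip: mult.assoc exp_add)
qed

lemma rescale_inverse': "rescale \<phi> \<psi> (rescale (\<lambda>x. - \<phi> x) (\<lambda>x. - \<psi> x) \<rho>) = \<rho>"
  using rescale_inverse[of "\<lambda>x. - \<phi> x" "\<lambda>x. - \<psi> x" \<rho>] by simp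

lemma mass_density_rescale: "mass_density \<Omega> \<rho> \<Longrightarrow> mass_density \<Omega> (rescale \<phi> \<psi> \<rho>)"
  by (simp add: mass_density_def rescale_def)

text \<open>The squared norm of the rescaled form carries exp(2 \<phi>), which the inner factor of
  \<open>rescale\<close> undoes; the outer factor then trades exp \<phi> for exp \<psi>.\<close>

lemma flux_rescale:
  "flux (rescale \<phi> \<psi> \<rho>) (\<lambda>x. exp (\<phi> x) *\<^sub>R \<omega> x) = (\<lambda>x. exp (\<psi> x) *\<^sub>R flux \<rho> \<omega> x)"
proof
  fix x
  have *: "exp (- 2 * \<phi> x) * norm_sq (exp (\<phi> x) *\<^sub>R \<omega> x) = norm_sq (\<omega> x)"
    by (simp add: norm_sq_scaleR power2_eq_square flip: mult.assoc exp_add)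
  show "flux (rescale \<phi> \<psi> \<rho>) (\<lambda>x. exp (\<phi> x) *\<^sub>R \<omega> x) x = exp (\<psi> x) *\<^sub>R flux \<rho> \<omega> x"
    unfolding flux_def rescale_def * by (simp add: exp_diff)
qed

text \<open>With \<open>\<eta>\<close> and \<open>\<zeta>\<close> arbitrary, one statement serves
  both to remove the coefficients and to restore them from zero.\<close>

lemma hodge_frobenius_solution_rescale:
  fixes \<phi> \<psi> \<eta> \<zeta> :: "('n::{finite,linorder}) pt \<Rightarrow> real"
  assumes C1: "Ck_on 1 \<Omega> \<phi>" "Ck_on 1 \<Omega> \<psi>" "Ck_on 1 \<Omega> \<eta>" "Ck_on 1 \<Omega> \<zeta>"
    and sol: "hodge_frobenius_solution k \<Omega> \<rho> (differential \<zeta>) (differential \<eta>) \<omega>"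
  shows "hodge_frobenius_solution k \<Omega> (rescale \<phi> \<psi> \<rho>)
    (differential (\<lambda>x. \<zeta> x + \<psi> x)) (differential (\<lambda>x. \<eta> x + \<phi> x)) (\<lambda>x. exp (\<phi> x) *\<^sub>R \<omega> x)"
proof -
  let ?F = "flux \<rho> \<omega>"
  have \<omega>: "form_on k \<Omega> \<omega>" "Ck_on 1 \<Omega> \<omega>" and F: "Ck_on 1 \<Omega> ?F"
    and eqs: "\<And>x. x \<in> \<Omega> \<Longrightarrow> ext_deriv (\<lambda>y. hodge_star (?F y)) x = differential \<zeta> x \<and>\<^sub>w hodge_star (?F x)"
      "\<And>x. x \<in> \<Omega> \<Longrightarrow> ext_deriv \<omega> x = differential \<eta> x \<and>\<^sub>w \<omega> x"
    using sol unfolding hodge_frobenius_solution_def by auto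
  have bl: "bounded_linear (hodge_star :: 'n ext \<Rightarrow> 'n ext)"
    by (simp add: linear_conv_bounded_linear[symmetric] linear_iff hodge_star_def vec_eq_iff
        algebra_simps)
  have "form_on k \<Omega> (\<lambda>x. exp (\<phi> x) *\<^sub>R \<omega> x)"
    using \<omega>(1) by (simp add: form_on_def homogeneous_def)
  moreover have "Ck_on 1 \<Omega> (\<lambda>x. exp (\<phi> x) *\<^sub>R \<omega> x)" "Ck_on 1 \<Omega> (\<lambda>x. exp (\<psi> x) *\<^sub>R ?F x)"
    using C1 \<omega>(2) F by (intro Ck_on_1_scaleR Ck_on_1_exp; simp only:)+
  moreover have "ext_deriv (\<lambda>y. hodge_star (exp (\<psi> y) *\<^sub>R ?F y)) x =
      differential (\<lambda>x. \<zeta> x + \<psi> x) x \<and>\<^sub>w hodge_star (exp (\<psi> x) *\<^sub>R ?F x)" if x: "x \<in> \<Omega>" for x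
  proof -
    \<comment> \<open>Differentiability comes from the flux as a whole, which is part of being a
      classical solution, and passes through the bounded linear star.\<close>
    have "(\<lambda>y. hodge_star (?F y)) differentiable (at x)"
      using F x bounded_linear.has_derivative[OF bl] by (force simp: differentiable_def)
    then show ?thesis
      unfolding hodge_star_scaleR using C1 x eqs(1)[OF x] by (intro ext_deriv_exp_scaleR) simp_all
  qed
  moreover have "ext_deriv (\<lambda>y. exp (\<phi> y) *\<^sub>R \<omega> y) x =
      differential (\<lambda>x. \<eta> x + \<phi> x) x \<and>\<^sub>w (exp (\<phi> x) *\<^sub>R \<omega> x)" if "x \<in> \<Omega>" for x
    using C1 \<omega>(2) that eqs(2)[OF that] by (intro ext_deriv_exp_scaleR) simp_all
  ultimately show ?thesis
    unfolding hodge_frobenius_solution_def flux_rescale by blast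
qed

text \<open>Up to sign \<open>codiff\<close> is star, d, star, and the outer star is injective. Zero
  coefficients appear as differentials of the zero function, the form required for
  rescaling.\<close>

lemma nonlinear_hodge_solution_iff:
  "nonlinear_hodge_solution k \<Omega> \<rho> \<omega> \<longleftrightarrow>
   hodge_frobenius_solution k \<Omega> \<rho> (differential (\<lambda>x. 0)) (differential (\<lambda>x. 0)) \<omega>"
  by (simp add: nonlinear_hodge_solution_def hodge_frobenius_solution_def codiff_def
      differential_zero wedge_zero_left hodge_star_eq_0_iff)

section \<open>Ellipticity and regularity of rescaled densities\<close>

text \<open>For fixed \<open>x\<close> the new density is m \<rho>(c Q) with positive constants m,
  c. The chain rule yields a factor c, which turns \<open>Q\<close> into c Q, so the ellipticity
  expression at c Q is just multiplied by the square of m.\<close>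

lemma elliptic_at_rescale:
  assumes "elliptic_at \<rho> x (exp (- 2 * \<phi> x) * Q)"
  shows "elliptic_at (rescale \<phi> \<psi> \<rho>) x Q"
proof -
  let ?c = "exp (- 2 * \<phi> x)" and ?m = "exp (\<psi> x - \<phi> x)"
  obtain r where r: "(\<rho> x has_real_derivative r) (at (?c * Q) within {0..})"
    and pos: "0 < (\<rho> x (?c * Q))\<^sup>2 + 2 * (?c * Q) * r * \<rho> x (?c * Q)"
    using assms unfolding elliptic_at_def by blast
  \<comment> \<open>Multiplication by \<open>?c\<close> maps the half-line into itself, so the chain
    rule also covers the one-sided derivative at \<open>Q = 0\<close>.\<close>
  have "(\<rho> x has_real_derivative r) (at (?c * Q) within (*) ?c ` {0..})"
    by (rule DERIV_subset[OF r]) auto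
  moreover have "((*) ?c has_real_derivative ?c) (at Q within {0..})"
    by (auto intro!: derivative_eq_intros)
  ultimately have "((\<rho> x \<circ> (*) ?c) has_real_derivative r * ?c) (at Q within {0..})"
    by (rule DERIV_image_chain)
  from DERIV_cmult[OF this, of ?m]
  have "(rescale \<phi> \<psi> \<rho> x has_real_derivative ?m * (r * ?c)) (at Q within {0..})"
    by (simp add: rescale_def[abs_def] comp_def)
  moreover have "(rescale \<phi> \<psi> \<rho> x Q)\<^sup>2 + 2 * Q * (?m * (r * ?c)) * rescale \<phi> \<psi> \<rho> x Q =
      ?m\<^sup>2 * ((\<rho> x (?c * Q))\<^sup>2 + 2 * (?c * Q) * r * \<rho> x (?c * Q))"
    unfolding rescale_def by (simp add: power2_eq_square algebra_simps)
  then have "0 < (rescale \<phi> \<psi> \<rho> x Q)\<^sup>2 + 2 * Q * (?m * (r * ?c)) * rescale \<phi> \<psi> \<rho> x Q"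
    using pos by simp
  ultimately show ?thesis
    unfolding elliptic_at_def by blast
qed

lemma elliptic_at_rescale_iff:
  "elliptic_at (rescale \<phi> \<psi> \<rho>) x Q \<longleftrightarrow> elliptic_at \<rho> x (exp (- 2 * \<phi> x) * Q)"
proof
  assume *: "elliptic_at (rescale \<phi> \<psi> \<rho>) x Q"
  \<comment> \<open>\<open>Q\<close> is rewritten to match the forward implication with opposite
    exponents, which turns the rescaled density back into \<open>\<rho>\<close>.\<close>
  have "exp (- 2 * - \<phi> x) * (exp (- 2 * \<phi> x) * Q) = Q"
    by (simp flip: mult.assoc exp_add)
  with * have "elliptic_at (rescale \<phi> \<psi> \<rho>) x (exp (- 2 * - \<phi> x) * (exp (- 2 * \<phi> x) * Q))"
    by (simp only:)
  from elliptic_at_rescale[of _ x "\<lambda>x. - \<phi> x", OF this, of "\<lambda>x. - \<psi> x"]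
  show "elliptic_at \<rho> x (exp (- 2 * \<phi> x) * Q)"
    by (simp only: rescale_inverse)
qed (rule elliptic_at_rescale)

lemma elliptic_rescale:
  assumes "elliptic \<Omega> \<rho>"
  shows "elliptic \<Omega> (rescale \<phi> \<psi> \<rho>)"
  using assms by (simp add: elliptic_def elliptic_at_rescale_iff)

text \<open>The rescaled density is a product of exponentials in x with \<open>\<rho>\<close>
  composed with a C1 map of \<Omega> \<times> [0, \<infinity>) into itself.\<close>

lemma C1_density_rescale:
  assumes "Ck_on 1 \<Omega> \<phi>" "Ck_on 1 \<Omega> \<psi>" "C1_density \<Omega> \<rho>"
  shows "C1_density \<Omega> (rescale \<phi> \<psi> \<rho>)"
proof -
  let ?S = "\<Omega> \<times> {0::real..}"
  have exp_fst: "C1_map_on ?S (\<lambda>p. exp (f (fst p)))" if "Ck_on 1 \<Omega> f" for f :: "'a pt \<Rightarrow> real"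
    by (rule C1_map_on_compose[OF C1_map_on_Ck_on[OF Ck_on_1_exp[OF that]]
        C1_map_on_bounded_linear[OF bounded_linear_fst]]) auto
  have E: "C1_map_on ?S (\<lambda>p. exp (- \<phi> (fst p)))" "C1_map_on ?S (\<lambda>p. exp (\<psi> (fst p)))"
    using exp_fst[OF Ck_on_1_uminus] exp_fst assms by blast+
  \<comment> \<open>The factor exp(-2 \<phi>) is written as the square of exp(-\<phi>), so that
    \<open>E\<close> and the product rule apply.\<close>
  have "C1_map_on ?S (\<lambda>p. (fst p, exp (- \<phi> (fst p)) * exp (- \<phi> (fst p)) * snd p))"
    by (intro C1_map_on_Pair C1_map_on_mult E C1_map_on_bounded_linear bounded_linear_fst
        bounded_linear_snd)
  then have "C1_map_on ?S (\<lambda>p. (\<lambda>(x, Q). \<rho> x Q)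
      (fst p, exp (- \<phi> (fst p)) * exp (- \<phi> (fst p)) * snd p))"
    by (rule C1_map_on_compose[OF assms(3)[unfolded C1_density_iff]]) auto
  then have "C1_map_on ?S (\<lambda>p. exp (\<psi> (fst p)) * exp (- \<phi> (fst p)) * (\<lambda>(x, Q). \<rho> x Q)
      (fst p, exp (- \<phi> (fst p)) * exp (- \<phi> (fst p)) * snd p))"
    by (intro C1_map_on_mult E)
  moreover have "exp (\<psi> x) * exp (- \<phi> x) = exp (\<psi> x - \<phi> x)"
      "exp (- \<phi> x) * exp (- \<phi> x) = exp (- 2 * \<phi> x)" for x
    by (simp_all flip: exp_add)
  ultimately show ?thesis
    by (simp add: C1_density_iff rescale_def case_prod_unfold)
qed

section \<open>The correspondence between the two systems\<close>

text \<open>The form scales by exp(-\<eta>), which is the conformal factor, and the flux by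
  exp(-\<zeta>); the new density reconciles the two.\<close>

lemma conformal_correspondence_rescale:
  fixes \<eta> \<zeta> :: "('n::{finite,linorder}) pt \<Rightarrow> real"
  assumes \<eta>: "Ck_on 1 \<Omega> \<eta>" and \<zeta>: "Ck_on 1 \<Omega> \<zeta>"
  shows "conformal_correspondence k \<Omega> (differential \<zeta>) (differential \<eta>) \<rho>
    (rescale (\<lambda>x. - \<eta> x) (\<lambda>x. - \<zeta> x) \<rho>)"
proof -
  let ?\<rho> = "rescale (\<lambda>x. - \<eta> x) (\<lambda>x. - \<zeta> x) \<rho>" and ?\<mu> = "\<lambda>x. exp (- \<eta> x)"
  note \<eta>' = Ck_on_1_uminus[OF \<eta>] and \<zeta>' = Ck_on_1_uminus[OF \<zeta>]
  \<comment> \<open>The zero function is the potential of both coefficients of the target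
    system.\<close>
  have zero: "Ck_on 1 \<Omega> (\<lambda>x::'n pt. 0 :: real)"
  proof -
    have "partial i (\<lambda>x::'n pt. 0 :: real) = (\<lambda>x. 0)" for i
      using partial_eqI[OF has_derivative_const] by blast
    then show ?thesis by simp
  qed
  have "nonlinear_hodge_solution k \<Omega> ?\<rho> (\<lambda>x. ?\<mu> x *\<^sub>R \<omega> x)"
    if "hodge_frobenius_solution k \<Omega> \<rho> (differential \<zeta>) (differential \<eta>) \<omega>" for \<omega>
    using hodge_frobenius_solution_rescale[OF \<eta>' \<zeta>' \<eta> \<zeta> that]
    by (simp add: nonlinear_hodge_solution_iff)
  then have 1: "\<exists>\<omega>\<^sub>0. nonlinear_hodge_solution k \<Omega> ?\<rho> \<omega>\<^sub>0 \<and> conformally_related \<Omega> ?\<mu> \<omega> \<omega>\<^sub>0"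
    if "hodge_frobenius_solution k \<Omega> \<rho> (differential \<zeta>) (differential \<eta>) \<omega>" for \<omega>
    using that unfolding conformally_related_def by blast
  have 2: "\<exists>\<omega>\<^sub>1. hodge_frobenius_solution k \<Omega> \<rho> (differential \<zeta>) (differential \<eta>) \<omega>\<^sub>1 \<and>
      conformally_related \<Omega> ?\<mu> \<omega>\<^sub>1 \<omega>" if "nonlinear_hodge_solution k \<Omega> ?\<rho> \<omega>" for \<omega>
  proof (intro exI conjI)
    \<comment> \<open>Starting from zero potentials, rescaling by \<open>\<eta>\<close> and
      \<open>\<zeta>\<close> restores both coefficients and the density.\<close>
    show "hodge_frobenius_solution k \<Omega> \<rho> (differential \<zeta>) (differential \<eta>) (\<lambda>x. exp (\<eta> x) *\<^sub>R \<omega> x)"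
      using hodge_frobenius_solution_rescale[OF \<eta> \<zeta> zero zero
          that[unfolded nonlinear_hodge_solution_iff]]
      by (simp add: rescale_inverse')
    show "conformally_related \<Omega> ?\<mu> (\<lambda>x. exp (\<eta> x) *\<^sub>R \<omega> x) \<omega>"
      by (simp add: conformally_related_def flip: exp_add)
  qed
  have 3: "elliptic_at \<rho> x (norm_sq (\<omega>\<^sub>1 x)) \<longleftrightarrow> elliptic_at ?\<rho> x (norm_sq (\<omega>\<^sub>0 x))"
    if "conformally_related \<Omega> ?\<mu> \<omega>\<^sub>1 \<omega>\<^sub>0" "x \<in> \<Omega>" for \<omega>\<^sub>1 \<omega>\<^sub>0 x
  proof -
    have "exp (- 2 * - \<eta> x) * norm_sq (\<omega>\<^sub>0 x) = norm_sq (\<omega>\<^sub>1 x)"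
      using that by (simp add: conformally_related_def norm_sq_scaleR power2_eq_square
          flip: mult.assoc exp_add)
    then show ?thesis by (simp only: elliptic_at_rescale_iff)
  qed
  have "conformal_factor \<Omega> ?\<mu>"
    using Ck_on_1_exp[OF \<eta>'] by (simp add: conformal_factor_def)
  \<comment> \<open>For the converse implication, rescaling \<open>?\<rho>\<close> by
    \<open>\<eta>\<close> and \<open>\<zeta>\<close> gives back \<open>\<rho>\<close>; likewise for
    \<open>C1_density\<close>.\<close>
  moreover have "elliptic \<Omega> \<rho> \<longleftrightarrow> elliptic \<Omega> ?\<rho>"
    using elliptic_rescale[of \<Omega> ?\<rho> \<eta> \<zeta>] elliptic_rescale[of \<Omega> \<rho>] by (auto simp: rescale_inverse')
  moreover have "C1_density \<Omega> \<rho> \<longleftrightarrow> C1_density \<Omega> ?\<rho>"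
    using C1_density_rescale[OF \<eta> \<zeta>, of ?\<rho>] C1_density_rescale[OF \<eta>' \<zeta>', of \<rho>]
    by (auto simp: rescale_inverse')
  ultimately show ?thesis
    unfolding conformal_correspondence_def using 1 2 3 by blast
qed

theorem proposition4p4:
  fixes \<Omega> :: "('n::{finite,linorder}) pt set"
    and \<eta> \<zeta> :: "'n pt \<Rightarrow> real"
    and k :: nat
  assumes "smooth_domain \<Omega>"
    and "Ck_on 1 \<Omega> \<eta>" and "Ck_on 1 \<Omega> \<zeta>"
  shows "(\<forall>\<rho>\<^sub>1. mass_density \<Omega> \<rho>\<^sub>1 \<longrightarrow>
            (\<exists>\<rho>\<^sub>0. mass_density \<Omega> \<rho>\<^sub>0 \<and>
              conformal_correspondence k \<Omega> (differential \<zeta>) (differential \<eta>) \<rho>\<^sub>1 \<rho>\<^sub>0)) \<and>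
         (\<forall>\<rho>\<^sub>0. mass_density \<Omega> \<rho>\<^sub>0 \<longrightarrow>
            (\<exists>\<rho>\<^sub>1. mass_density \<Omega> \<rho>\<^sub>1 \<and>
              conformal_correspondence k \<Omega> (differential \<zeta>) (differential \<eta>) \<rho>\<^sub>1 \<rho>\<^sub>0))"
proof (intro conjI allI impI)
  fix \<rho> assume "mass_density \<Omega> \<rho>"
  then show "\<exists>\<rho>\<^sub>0. mass_density \<Omega> \<rho>\<^sub>0 \<and>
      conformal_correspondence k \<Omega> (differential \<zeta>) (differential \<eta>) \<rho> \<rho>\<^sub>0"
    using mass_density_rescale conformal_correspondence_rescale[OF assms(2,3)] by blast
next
  fix \<rho> assume "mass_density \<Omega> \<rho>"
  \<comment> \<open>The witness is the inverse rescaling of the given density, whose own rescaling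
    by the negated exponents is that density again.\<close>
  moreover have "conformal_correspondence k \<Omega> (differential \<zeta>) (differential \<eta>) (rescale \<eta> \<zeta> \<rho>) \<rho>"
    using conformal_correspondence_rescale[OF assms(2,3), of k "rescale \<eta> \<zeta> \<rho>"]
    by (simp only: rescale_inverse)
  ultimately show "\<exists>\<rho>\<^sub>1. mass_density \<Omega> \<rho>\<^sub>1 \<and>
      conformal_correspondence k \<Omega> (differential \<zeta>) (differential \<eta>) \<rho>\<^sub>1 \<rho>"
    using mass_density_rescale by blast
qed

end
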